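(* Let $p\ge 5$ be a prime and let $q_p(2)=\frac{2^{p-1}-1}{p}$. Then $$q_p(2)^2\equiv -\sum_{k=1}^{p-1}\frac{2^k}{k^2}\pmod{p}.$$
   Context: The integer $q_p(2)=(2^{p-1}-1)/p$ is the Fermat quotient of $p$ to base $2$. Congruences modulo $p$ are between rational numbers whose denominators (in lowest terms) are not divisible by $p$: $x\equiv y\pmod p$ means that the numerator of $x-y$ in lowest terms is divisible by $p$ (equivalently $x-y\in p\mathbb{Z}_{(p)}$). *)

theory Defs
  imports Complex_Main "HOL-Computational_Algebra.Primes"
begin

definition rat_num :: "rat \<Rightarrow> int" where
  "rat_num x = fst (quotient_of x)"

definition rat_den :: "rat \<Rightarrow> int" where
  "rat_den x = snd (quotient_of x)"

(* The congruence is only meaningful between rationals whose denominators are not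
   divisible by p, so this is required of both sides as part of the relation. *)
definition rat_cong :: "nat \<Rightarrow> rat \<Rightarrow> rat \<Rightarrow> bool" where
  "rat_cong p x y \<longleftrightarrow>
     \<not> int p dvd rat_den x \<and> \<not> int p dvd rat_den y \<and> int p dvd rat_num (x - y)"

(* The division is the exact one in the rationals, not the truncating div. *)
definition fermat_quotient :: "nat \<Rightarrow> int \<Rightarrow> rat" where
  "fermat_quotient p a = (of_int a ^ (p - 1) - 1) / of_nat p"

end

theory Submission
  imports Defs
begin

text \<open>
  Write \<open>G(x) = \<Sum>k=1..p-1. x^k / k^2\<close>; congruences are modulo \<open>p\<close>. The square
  \<open>q_p(2)^2\<close> and the value \<open>G(2)\<close> are both expressed by sums of reciprocals \<open>1/j\<close> and
  \<open>1/(jm)\<close> with parity conditions, and these are evaluated by the reflection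
  \<open>k \<mapsto> p - k\<close>, which exchanges odd and even indices and changes the sign of \<open>1/k\<close>.

  On one side, expanding \<open>2^p = (1+1)^p\<close> gives \<open>2 q_p(2)\<close> as the alternating harmonic sum,
  so that \<open>q_p(2)\<close> is congruent to \<open>S\<close>, the sum of \<open>1/k\<close> over the odd \<open>k < p\<close>
  (\<open>fermat_quotient_2_cong\<close>).

  On the other side, \<open>binomial (p-1) k\<close> is congruent to \<open>(-1)^k\<close>, so \<open>G(x)\<close> is congruent to
  \<open>\<Sum>k. binomial (p-1) k (-x)^k / k^2\<close>, which an exact identity turns into the double sum of
  \<open>((1-x)^j - 1) / (jm)\<close> over \<open>1 \<le> j \<le> m < p\<close> (\<open>dilog_cong\<close>). At \<open>x = 2\<close> only odd
  \<open>j\<close> survive, with coefficient \<open>-2\<close>. The pairs with \<open>m\<close> odd contribute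
  \<open>-S^2 - (\<Sum>k odd. 1/k^2)\<close>, because a sum over \<open>j \<le> m\<close> that is symmetric in its
  indices is half of the full square plus half of the diagonal. It remains that two sums vanish
  modulo \<open>p\<close>.

  For the sum of \<open>1/k^2\<close> over odd \<open>k\<close>, which by reflection is half of the sum \<open>G(1)\<close> over
  all \<open>k\<close>, take \<open>x = 1\<close> in the same congruence: it makes \<open>3 G(1)\<close> congruent to \<open>-H^2\<close> with \<open>H\<close>
  the harmonic sum, which is \<open>0\<close> by reflection (\<open>sum_inverse_squares\<close>).

  For \<open>B\<close>, the sum of \<open>1/(jm)\<close> over odd \<open>j\<close> less than even \<open>m\<close>, reflection of \<open>m\<close> gives
  \<open>B = -C\<close> modulo \<open>p\<close>, where \<open>C\<close> is the sum of \<open>1/(jk)\<close> over odd \<open>j, k\<close> with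
  \<open>j + k < p\<close>; and partial fractions, \<open>1/(jk) = (1/j + 1/k) / (j+k)\<close>, give \<open>C = 2 B\<close>
  exactly. Hence \<open>3 B\<close> vanishes (\<open>sum_odd_less_even\<close>). Both times the factor \<open>3\<close> is a unit
  since \<open>p \<ge> 5\<close>.
\<close>

section \<open>Sums over ordered pairs and binomial sums\<close>

lemma sum_le_pairs:
  fixes a :: "'i::linorder \<Rightarrow> 'a::comm_ring_1"
  assumes "finite A"
  shows "2 * (\<Sum>m\<in>A. \<Sum>j | j \<in> A \<and> j \<le> m. a j * a m) = (\<Sum>j\<in>A. a j)\<^sup>2 + (\<Sum>j\<in>A. (a j)\<^sup>2)"
  using assms
proof (induction A rule: finite_linorder_max_induct)
  case empty
  then show ?case by simp
next
  case (insert b A)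
  have b: "b \<notin> A" using insert by auto
  have top: "{j. j \<in> insert b A \<and> j \<le> b} = insert b A"
    using insert.hyps by auto
  have old: "{j. j \<in> insert b A \<and> j \<le> m} = {j. j \<in> A \<and> j \<le> m}" if "m \<in> A" for m
    using insert.hyps that by force
  have "(\<Sum>m\<in>insert b A. \<Sum>j | j \<in> insert b A \<and> j \<le> m. a j * a m)
      = (\<Sum>j\<in>insert b A. a j * a b) + (\<Sum>m\<in>A. \<Sum>j | j \<in> A \<and> j \<le> m. a j * a m)"
    unfolding sum.insert[OF insert.hyps(1) b, of "\<lambda>m. \<Sum>j | j \<in> insert b A \<and> j \<le> m. a j * a m"] top
    by (simp add: old del: insert_iff)
  also have "(\<Sum>j\<in>insert b A. a j * a b) = (a b)\<^sup>2 + (\<Sum>j\<in>A. a j) * a b"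
    using insert.hyps(1) b by (simp add: power2_eq_square sum_distrib_right)
  finally show ?case
    using insert.hyps(1) b insert.IH
    by (simp add: power2_eq_square distrib_left distrib_right mult.commute)
qed

text \<open>
  Dividing the terms of a binomial sum by \<open>k\<close> amounts to averaging over the smaller rows: by
  Pascal's rule the left-hand side grows from \<open>n - 1\<close> to \<open>n\<close> by
  \<open>\<Sum>k. binomial (n-1) (k-1) c_k / k\<close>, and absorption turns this into \<open>1/n\<close> times the
  \<open>n\<close>-th binomial sum. Applied repeatedly, it handles powers of \<open>k\<close> in the denominator.
\<close>
lemma sum_binomial_div:
  fixes c :: "nat \<Rightarrow> 'a::field_char_0"
  shows "(\<Sum>k=1..n. of_nat (n choose k) * c k / of_nat k)
       = (\<Sum>m=1..n. (\<Sum>k=1..m. of_nat (m choose k) * c k) / of_nat m)"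
proof (induction n)
  case 0
  then show ?case by simp
next
  case (Suc n)
  have absorb: "of_nat (n choose (k - 1)) / (of_nat k :: 'a) = of_nat (Suc n choose k) / of_nat (Suc n)"
    if "k \<in> {1..Suc n}" for k
  proof -
    have "of_nat (k * (Suc n choose k)) = (of_nat (Suc n * (n choose (k - 1))) :: 'a)"
      using that by (metis atLeastAtMost_iff binomial_absorption Suc_diff_1 diff_Suc_1 less_eq_Suc_le One_nat_def)
    then have "of_nat k * of_nat (Suc n choose k) = (of_nat (Suc n) * of_nat (n choose (k - 1)) :: 'a)"
      by (simp only: of_nat_mult)
    then show ?thesis
      using that by (simp add: nonzero_divide_eq_eq nonzero_eq_divide_eq mult.commute del: binomial_Suc_Suc of_nat_Suc)
  qed
  have "(\<Sum>k=1..Suc n. of_nat (Suc n choose k) * c k / of_nat k)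
      = (\<Sum>k=1..Suc n. of_nat (n choose k) * c k / of_nat k + of_nat (n choose (k - 1)) / of_nat k * c k)"
  proof (rule sum.cong[OF refl])
    fix k assume "k \<in> {1..Suc n}"
    then obtain l where "k = Suc l" by (cases k) auto
    then show "of_nat (Suc n choose k) * c k / of_nat k
      = of_nat (n choose k) * c k / of_nat k + of_nat (n choose (k - 1)) / of_nat k * c k"
      by (simp add: algebra_simps add_divide_distrib del: of_nat_Suc)
  qed
  also have "\<dots> = (\<Sum>k=1..n. of_nat (n choose k) * c k / of_nat k)
      + (\<Sum>k=1..Suc n. of_nat (n choose (k - 1)) / of_nat k * c k)"
    by (simp add: sum.distrib)
  also have "(\<Sum>k=1..Suc n. of_nat (n choose (k - 1)) / of_nat k * c k)
      = (\<Sum>k=1..Suc n. of_nat (Suc n choose k) * c k) / of_nat (Suc n)"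
    unfolding sum_divide_distrib by (rule sum.cong[OF refl]) (simp only: absorb, simp)
  finally show ?case using Suc.IH by simp
qed

lemma sum_binomial_div_square:
  fixes x :: "'a::field_char_0"
  shows "(\<Sum>k=1..n. of_nat (n choose k) * (- x) ^ k / (of_nat k)\<^sup>2)
       = (\<Sum>m=1..n. \<Sum>j=1..m. ((1 - x) ^ j - 1) / (of_nat j * of_nat m))"
proof -
  have row: "(\<Sum>k=1..m. of_nat (m choose k) * (- x) ^ k) = (1 - x) ^ m - 1" for m
  proof -
    have "(1 - x) ^ m = (\<Sum>k=0..m. of_nat (m choose k) * (- x) ^ k)"
      using binomial_ring[of "- x" 1 m] by (simp add: atLeast0AtMost)
    also have "\<dots> = 1 + (\<Sum>k=1..m. of_nat (m choose k) * (- x) ^ k)"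
      by (simp add: sum.atLeast_Suc_atMost)
    finally show ?thesis by simp
  qed
  have "(\<Sum>k=1..n. of_nat (n choose k) * (- x) ^ k / (of_nat k)\<^sup>2)
      = (\<Sum>k=1..n. of_nat (n choose k) * ((- x) ^ k / of_nat k) / of_nat k)"
    by (simp add: power2_eq_square)
  also have "\<dots> = (\<Sum>m=1..n. (\<Sum>k=1..m. of_nat (m choose k) * (- x) ^ k / of_nat k) / of_nat m)"
    by (subst sum_binomial_div) simp
  also have "\<dots> = (\<Sum>m=1..n. (\<Sum>j=1..m. ((1 - x) ^ j - 1) / of_nat j) / of_nat m)"
    by (simp only: sum_binomial_div row)
  finally show ?thesis by (simp add: sum_divide_distrib)
qed

section \<open>Congruences in the localization of the integers at a prime\<close>

definition local_ints :: "nat \<Rightarrow> rat set" where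
  "local_ints p = {of_int a / of_int b | a b. \<not> int p dvd b}"

text \<open>
  The quotient of the difference by \<open>p\<close> is required to be \<open>p\<close>-integral, so that the relation
  is stable under sums and under multiplication by \<open>p\<close>-integral factors without any reference
  to lowest terms.
\<close>
definition local_cong :: "nat \<Rightarrow> rat \<Rightarrow> rat \<Rightarrow> bool" where
  "local_cong p x y \<longleftrightarrow> (\<exists>r \<in> local_ints p. x - y = of_nat p * r)"

lemma local_intsI: "\<not> int p dvd b \<Longrightarrow> x = of_int a / of_int b \<Longrightarrow> x \<in> local_ints p"
  unfolding local_ints_def by blast

lemma local_intsE:
  assumes "x \<in> local_ints p"
  obtains a b where "\<not> int p dvd b" "b \<noteq> 0" "x = of_int a / of_int b"
proof -
  obtain a b where "\<not> int p dvd b" "x = of_int a / of_int b"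
    using assms unfolding local_ints_def by blast
  then show ?thesis using that[of b a] by auto
qed

context
  fixes p :: nat
  assumes prime: "prime p"
begin

text \<open>
  The passage to lowest terms: if \<open>z = a/b = n/d\<close> with \<open>n, d\<close> coprime, then
  \<open>n b = a d\<close>, so that \<open>d\<close> divides \<open>b\<close>, and a factor \<open>p\<close> of \<open>a\<close> must divide \<open>n\<close>
  when \<open>b\<close> is prime to \<open>p\<close>.
\<close>
lemma local_cong_imp_rat_cong:
  assumes "x \<in> local_ints p" "y \<in> local_ints p" "local_cong p x y"
  shows "rat_cong p x y"
proof -
  have ip: "prime (int p)" using prime by simp
  have key: "\<exists>n d. quotient_of z = (n, d) \<and> d > 0 \<and> coprime n d \<and> n * b = a * d"
    if "b \<noteq> 0" "z = of_int a / of_int b" for z a b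
  proof -
    obtain n d where q: "quotient_of z = (n, d)" by (cases "quotient_of z")
    have "of_int n / of_int d = (of_int a / of_int b :: rat)" "d > 0" "coprime n d"
      using quotient_of_div[OF q] that quotient_of_denom_pos[OF q] quotient_of_coprime[OF q] by auto
    moreover from this have "of_int (n * b) = (of_int (a * d) :: rat)"
      using that(1) by (simp add: field_simps)
    ultimately show ?thesis using q by (metis of_int_eq_iff)
  qed
  have den: "\<not> int p dvd rat_den z" if z: "z \<in> local_ints p" for z
  proof -
    obtain a b where ab: "\<not> int p dvd b" "b \<noteq> 0" "z = of_int a / of_int b"
      using z by (rule local_intsE)
    obtain n d where nd: "quotient_of z = (n, d)" "coprime n d" "n * b = a * d"
      using key[OF ab(2,3)] by blast
    have "d dvd b" using nd by (metis coprime_commute coprime_dvd_mult_right_iff dvd_triv_right)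
    then show ?thesis using ab(1) nd(1) by (auto simp: rat_den_def dest: dvd_trans)
  qed
  obtain r where r: "r \<in> local_ints p" "x - y = of_nat p * r"
    using assms(3) unfolding local_cong_def by blast
  obtain a b where ab: "\<not> int p dvd b" "b \<noteq> 0" "r = of_int a / of_int b"
    using r(1) by (rule local_intsE)
  have "x - y = of_int (int p * a) / of_int b" using r ab by simp
  then obtain n d where nd: "quotient_of (x - y) = (n, d)" "n * b = int p * a * d"
    using key[OF ab(2)] by blast
  have "int p dvd n * b" using nd(2) by (simp add: mult.assoc)
  then have "int p dvd n" using ab(1) ip by (simp add: prime_dvd_mult_iff)
  then show ?thesis
    unfolding rat_cong_def using den assms(1,2) nd(1) by (simp add: rat_num_def)
qed

lemma local_ints_of_int [simp]: "of_int a \<in> local_ints p"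
  by (rule local_intsI[of _ 1 _ a]) (use prime in auto)

lemma local_ints_simps [simp]:
  "0 \<in> local_ints p" "1 \<in> local_ints p" "of_nat n \<in> local_ints p" "numeral w \<in> local_ints p"
  using local_ints_of_int[of 0] local_ints_of_int[of 1] local_ints_of_int[of "int n"]
    local_ints_of_int[of "numeral w"] by simp_all

lemma local_ints_mult:
  assumes "x \<in> local_ints p" "y \<in> local_ints p"
  shows "x * y \<in> local_ints p"
proof -
  obtain a b c d where "\<not> int p dvd b" "b \<noteq> 0" "x = of_int a / of_int b"
    "\<not> int p dvd d" "d \<noteq> 0" "y = of_int c / of_int d"
    using assms by (meson local_intsE)
  then show ?thesis
    using prime by (intro local_intsI[of _ "b * d" _ "a * c"]) (auto simp: prime_dvd_mult_iff)
qed

lemma local_ints_add: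
  assumes "x \<in> local_ints p" "y \<in> local_ints p"
  shows "x + y \<in> local_ints p"
proof -
  obtain a b c d where "\<not> int p dvd b" "b \<noteq> 0" "x = of_int a / of_int b"
    "\<not> int p dvd d" "d \<noteq> 0" "y = of_int c / of_int d"
    using assms by (meson local_intsE)
  then show ?thesis
    using prime by (intro local_intsI[of _ "b * d" _ "a * d + c * b"])
      (auto simp: prime_dvd_mult_iff field_simps)
qed

lemma local_ints_uminus: "x \<in> local_ints p \<Longrightarrow> - x \<in> local_ints p"
  using local_ints_mult[of "of_int (-1)" x] local_ints_of_int[of "-1"] by simp

lemma local_ints_power: "x \<in> local_ints p \<Longrightarrow> x ^ n \<in> local_ints p"
  by (induction n) (auto intro: local_ints_mult)

lemma local_ints_sum: "(\<And>i. i \<in> A \<Longrightarrow> f i \<in> local_ints p) \<Longrightarrow> sum f A \<in> local_ints p"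
  by (induction A rule: infinite_finite_induct) (auto intro: local_ints_add)

lemma local_ints_inverse: "0 < k \<Longrightarrow> k < p \<Longrightarrow> 1 / of_nat k \<in> local_ints p"
  by (rule local_intsI[of _ "int k" _ 1]) (auto simp: zdvd_not_zless)

lemma local_ints_div:
  "x \<in> local_ints p \<Longrightarrow> 0 < k \<Longrightarrow> k < p \<Longrightarrow> x / of_nat k \<in> local_ints p"
  using local_ints_mult[OF _ local_ints_inverse, of x k] by simp

lemmas local_ints_intros = local_ints_mult local_ints_add local_ints_uminus
  local_ints_power local_ints_sum local_ints_div

lemma local_cong_refl [simp]: "local_cong p x x"
  unfolding local_cong_def by (rule bexI[of _ 0]) auto

lemma local_cong_add: "local_cong p x y \<Longrightarrow> local_cong p u v \<Longrightarrow> local_cong p (x + u) (y + v)"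
  unfolding local_cong_def
  by (metis (no_types, opaque_lifting) local_ints_add add_diff_add distrib_left)

lemma local_cong_mult_left:
  "c \<in> local_ints p \<Longrightarrow> local_cong p x y \<Longrightarrow> local_cong p (c * x) (c * y)"
  unfolding local_cong_def
  by (metis (no_types, opaque_lifting) local_ints_mult mult.left_commute right_diff_distrib)

lemma local_cong_uminus: "local_cong p x y \<Longrightarrow> local_cong p (- x) (- y)"
  using local_cong_mult_left[of "of_int (-1)" x y] local_ints_of_int[of "-1"] by simp

lemma local_cong_sym: "local_cong p x y \<Longrightarrow> local_cong p y x"
  using local_cong_add[OF local_cong_uminus[of x y] local_cong_refl[of "x + y"]] by simp

lemma local_cong_trans [trans]:
  "local_cong p x y \<Longrightarrow> local_cong p y z \<Longrightarrow> local_cong p x z"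
  using local_cong_add[of x y "y - y" "z - y"] local_cong_add[of y z "-y" "-y"] by simp

lemma local_cong_sum:
  "(\<And>i. i \<in> A \<Longrightarrow> local_cong p (f i) (g i)) \<Longrightarrow> local_cong p (sum f A) (sum g A)"
  by (induction A rule: infinite_finite_induct) (auto intro: local_cong_add)

lemma local_cong_power2:
  assumes "x \<in> local_ints p" "y \<in> local_ints p" "local_cong p x y"
  shows "local_cong p (x\<^sup>2) (y\<^sup>2)"
proof -
  have "local_cong p (x * x) (x * y)" using assms by (intro local_cong_mult_left)
  also have "local_cong p (x * y) (y * y)"
    using local_cong_mult_left[OF assms(2,3)] by (simp add: mult.commute)
  finally show ?thesis by (simp add: power2_eq_square)
qed

lemma local_cong_cancel:
  assumes "0 < k" "k < p" "local_cong p (of_nat k * x) (of_nat k * y)"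
  shows "local_cong p x y"
  using local_cong_mult_left[OF local_ints_inverse[OF assms(1,2)] assms(3)] assms(1) by simp

lemma inverse_reflect:
  assumes "0 < k" "k < p"
  shows "local_cong p (1 / of_nat (p - k)) (- (1 / of_nat k))"
  unfolding local_cong_def
proof (rule bexI)
  show "1 / of_nat (p - k) - - (1 / of_nat k) = of_nat p * (1 / of_nat (p - k) * (1 / of_nat k :: rat))"
    using assms by (simp add: of_nat_diff field_simps)
  show "1 / of_nat (p - k) * (1 / of_nat k) \<in> local_ints p"
    using assms by (intro local_ints_mult local_ints_inverse) auto
qed

section \<open>The truncated dilogarithm and the Fermat quotient\<close>

text \<open>
  Neighbouring entries of row \<open>p - 1\<close> of Pascal's triangle add up to an inner entry of row
  \<open>p\<close>, which \<open>p\<close> divides; so the entries alternate in sign, starting from \<open>1\<close>.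
\<close>
lemma binomial_prime_pred:
  assumes "k < p"
  shows "local_cong p (of_nat ((p - 1) choose k)) ((-1) ^ k)"
  using assms
proof (induction k)
  case 0
  then show ?case by simp
next
  case (Suc k)
  have "p dvd (p choose Suc k)" using Suc.prems prime by (intro dvd_choose_prime) auto
  moreover have "p choose Suc k = (p - 1 choose k) + (p - 1 choose Suc k)"
    using Suc.prems by (cases p) auto
  ultimately obtain t where t: "(p - 1 choose k) + (p - 1 choose Suc k) = p * t" by (auto elim: dvdE)
  have e: "of_nat (p - 1 choose k) + of_nat (p - 1 choose Suc k) = (of_nat p * of_nat t :: rat)"
    using arg_cong[OF t, of "of_nat :: nat \<Rightarrow> rat"] by simp
  then have "local_cong p (of_nat (p - 1 choose Suc k)) (- of_nat (p - 1 choose k))"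
    unfolding local_cong_def by (intro bexI[of _ "of_nat t"]) (auto simp: algebra_simps)
  also have "local_cong p (- of_nat (p - 1 choose k)) (- ((-1) ^ k))"
    using Suc by (intro local_cong_uminus) auto
  finally show ?case by simp
qed

text \<open>
  The substitute for the functional equations of the dilogarithm: only the values \<open>x = 1\<close> and
  \<open>x = 2\<close> are used below, where \<open>(1 - x)^j\<close> is \<open>0\<close> and \<open>(-1)^j\<close>.
\<close>
lemma dilog_cong:
  "local_cong p (\<Sum>k=1..p-1. of_int x ^ k / (of_nat k)\<^sup>2)
     (\<Sum>m=1..p-1. \<Sum>j=1..m. ((1 - of_int x) ^ j - 1) / (of_nat j * of_nat m))"
proof -
  have "local_cong p (\<Sum>k=1..p-1. of_nat (p - 1 choose k) * (- of_int x) ^ k / (of_nat k)\<^sup>2)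
      (\<Sum>k=1..p-1. of_int x ^ k / (of_nat k)\<^sup>2)"
  proof (rule local_cong_sum)
    fix k assume "k \<in> {1..p-1}"
    then have k: "0 < k" "k < p" by auto
    have "(- of_int x) ^ k * (1 / of_nat k)\<^sup>2 \<in> local_ints p"
      using k by (intro local_ints_mult local_ints_power local_ints_uminus local_ints_inverse) auto
    from local_cong_mult_left[OF this binomial_prime_pred[OF k(2)]]
    show "local_cong p (of_nat (p - 1 choose k) * (- of_int x) ^ k / (of_nat k)\<^sup>2)
            (of_int x ^ k / (of_nat k)\<^sup>2)"
      by (simp add: power_divide mult.commute flip: power_mult_distrib)
  qed
  then show ?thesis by (subst (asm) sum_binomial_div_square) (rule local_cong_sym)
qed


text \<open>
  The inner terms of \<open>(1+1)^p\<close> sum to \<open>2^p - 2 = 2 p q_p(2)\<close>, and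
  \<open>k binomial p k = p binomial (p-1) (k-1)\<close> removes the factor \<open>p\<close>; all
  denominators on the right-hand side are less than \<open>p\<close>.
\<close>
lemma fermat_quotient_2_eq:
  "2 * fermat_quotient p 2 = (\<Sum>k=1..p-1. of_nat (p - 1 choose (k - 1)) / of_nat k)"
proof -
  obtain n where n: "p = Suc n" "n > 0" using prime_gt_1_nat[OF prime] by (cases p) auto
  have "(\<Sum>k=1..n. of_nat (n choose (k - 1)) / of_nat k)
      = (\<Sum>k=1..n. of_nat (p choose k) / (of_nat p :: rat))"
  proof (rule sum.cong[OF refl])
    fix k assume k: "k \<in> {1..n}"
    then have "k * (p choose k) = p * (n choose (k - 1))"
      using binomial_absorption[of "k - 1" p] n by simp
    then have "of_nat k * of_nat (p choose k) = (of_nat p * of_nat (n choose (k - 1)) :: rat)"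
      by (metis of_nat_mult)
    then show "of_nat (n choose (k - 1)) / of_nat k = of_nat (p choose k) / (of_nat p :: rat)"
      using k n(1) by (simp add: field_simps del: of_nat_Suc binomial_Suc_Suc)
  qed
  also have "\<dots> = of_nat (\<Sum>k=1..n. p choose k) / of_nat p"
    by (simp add: sum_divide_distrib)
  also have "(\<Sum>k=1..n. p choose k) = 2 ^ p - 2"
  proof -
    have "2 ^ p = (\<Sum>k\<le>p. p choose k)" by (rule choose_row_sum[symmetric])
    also have "\<dots> = (\<Sum>k=0..n. p choose k) + 1"
      using n by (simp add: atLeast0AtMost del: binomial_Suc_Suc)
    also have "\<dots> = (\<Sum>k=1..n. p choose k) + 2"
      by (simp add: sum.atLeast_Suc_atMost)
    finally show ?thesis by simp
  qed
  also have "of_nat (2 ^ p - 2) = (2 * (2 ^ n - 1) :: rat)"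
    using n by (simp add: of_nat_diff)
  finally show ?thesis by (simp add: fermat_quotient_def n(1))
qed

section \<open>Reciprocal sums with parity conditions\<close>

context
  assumes p_ge: "p \<ge> 5"
begin

lemma p_odd: "odd p"
  using prime p_ge prime_odd_nat by auto

definition odds :: "nat set" where "odds = {j \<in> {1..p-1}. odd j}"
definition evens :: "nat set" where "evens = {j \<in> {1..p-1}. even j}"

lemma sum_parity: "(\<Sum>k=1..p-1. f k) = sum f odds + sum f evens"
  unfolding odds_def evens_def by (subst sum.union_disjoint[symmetric]) (auto intro: sum.cong)

lemma sum_evens_reflect: "sum f evens = (\<Sum>k\<in>odds. f (p - k))"
  by (rule sum.reindex_bij_witness[of _ "\<lambda>k. p - k" "\<lambda>k. p - k"])
    (use p_odd in \<open>auto simp: odds_def evens_def\<close>)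

lemma odds_range: "j \<in> odds \<Longrightarrow> 0 < j \<and> j < p"
  by (auto simp: odds_def)

lemma sum_evens_inverse:
  "local_cong p (\<Sum>k\<in>evens. 1 / of_nat k) (- (\<Sum>k\<in>odds. 1 / of_nat k))"
  unfolding sum_evens_reflect sum_negf[symmetric]
  by (intro local_cong_sum inverse_reflect) (auto dest: odds_range)

lemma fermat_quotient_2_cong:
  "local_cong p (fermat_quotient p 2) (\<Sum>k\<in>odds. 1 / of_nat k)"
proof (rule local_cong_cancel[of 2])
  have "local_cong p (2 * fermat_quotient p 2) (\<Sum>k=1..p-1. (-1) ^ (k - 1) / of_nat k)"
    unfolding fermat_quotient_2_eq
  proof (rule local_cong_sum)
    fix k assume "k \<in> {1..p-1}"
    then have "0 < k" "k < p" "k - 1 < p" by auto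
    then show "local_cong p (of_nat (p - 1 choose (k - 1)) / of_nat k) ((-1) ^ (k - 1) / of_nat k)"
      using local_cong_mult_left[OF local_ints_inverse binomial_prime_pred, of k "k - 1"] by simp
  qed
  also have "(\<Sum>k=1..p-1. (-1) ^ (k - 1) / (of_nat k :: rat))
      = (\<Sum>k\<in>odds. 1 / of_nat k) - (\<Sum>k\<in>evens. 1 / of_nat k)"
    unfolding sum_parity diff_conv_add_uminus sum_negf[symmetric]
    by (intro arg_cong2[of _ _ _ _ "(+)"] sum.cong) (auto simp: odds_def evens_def)
  also have "local_cong p \<dots> (of_nat 2 * (\<Sum>k\<in>odds. 1 / of_nat k))"
    using local_cong_add[OF local_cong_refl local_cong_uminus[OF sum_evens_inverse],
        of "\<Sum>k\<in>odds. 1 / of_nat k"] by simp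
  finally show "local_cong p (of_nat 2 * fermat_quotient p 2) (of_nat 2 * (\<Sum>k\<in>odds. 1 / of_nat k))"
    by simp
qed (use p_ge in auto)

text \<open>
  At \<open>x = 1\<close> the left-hand side of \<open>dilog_cong\<close> is the sum \<open>H2\<close> of inverse squares itself
  and the right-hand side is \<open>-(H^2 + H2)/2\<close>; doubling and collecting terms shows that
  \<open>3 H2\<close> is congruent to \<open>-H^2\<close>, and \<open>H\<close> vanishes by reflection.
\<close>
lemma sum_inverse_squares: "local_cong p (\<Sum>k=1..p-1. (1 / of_nat k)\<^sup>2) 0"
proof (rule local_cong_cancel[of 3])
  let ?H = "\<Sum>k=1..p-1. 1 / of_nat k :: rat" and ?H2 = "\<Sum>k=1..p-1. (1 / of_nat k)\<^sup>2 :: rat"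
  have "local_cong p ?H 0"
    unfolding sum_parity
    using local_cong_add[OF local_cong_refl sum_evens_inverse, of "\<Sum>k\<in>odds. 1 / of_nat k"] by simp
  moreover have "?H \<in> local_ints p" by (auto intro!: local_ints_intros)
  ultimately have H: "local_cong p (?H\<^sup>2) 0" using local_cong_power2[of ?H 0] by simp
  have le: "{j. j \<in> {1..p-1} \<and> j \<le> m} = {1..m}" if "m \<in> {1..p-1}" for m
    using that by auto
  have "local_cong p ?H2 (\<Sum>m=1..p-1. \<Sum>j=1..m. (0 ^ j - 1) / (of_nat j * of_nat m))"
    using dilog_cong[of 1] by (simp add: power_divide)
  also have "(\<Sum>m=1..p-1. \<Sum>j=1..m. (0 ^ j - 1) / (of_nat j * of_nat m))
      = - (\<Sum>m=1..p-1. \<Sum>j | j \<in> {1..p-1} \<and> j \<le> m. 1 / of_nat j * (1 / of_nat m :: rat))"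
    unfolding sum_negf[symmetric] by (intro sum.cong refl) (auto simp: le power_0_left)
  finally have "local_cong p (2 * ?H2) (2 * \<dots>)"
    by (intro local_cong_mult_left) auto
  also have "2 * - (\<Sum>m=1..p-1. \<Sum>j | j \<in> {1..p-1} \<and> j \<le> m. 1 / of_nat j * (1 / of_nat m :: rat))
      = - (?H\<^sup>2) - ?H2"
    using sum_le_pairs[of "{1..p-1}" "\<lambda>j. 1 / of_nat j :: rat"] by simp
  finally have "local_cong p (2 * ?H2 + ?H2) (- (?H\<^sup>2) - ?H2 + ?H2)"
    by (intro local_cong_add) auto
  also have "local_cong p (- (?H\<^sup>2) - ?H2 + ?H2) 0"
    using local_cong_uminus[OF H] by simp
  finally show "local_cong p (of_nat 3 * ?H2) (of_nat 3 * 0)" by simp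
qed (use p_ge in auto)

lemma sum_odds_inverse_squares: "local_cong p (\<Sum>k\<in>odds. (1 / of_nat k)\<^sup>2) 0"
proof (rule local_cong_cancel[of 2])
  have "local_cong p (\<Sum>k\<in>odds. (- (1 / of_nat k))\<^sup>2) (\<Sum>k\<in>odds. (1 / of_nat (p - k))\<^sup>2)"
  proof (rule local_cong_sum)
    fix k assume "k \<in> odds"
    then have k: "0 < k" "k < p" by (auto dest: odds_range)
    then show "local_cong p ((- (1 / of_nat k))\<^sup>2) ((1 / of_nat (p - k))\<^sup>2)"
      by (intro local_cong_power2 local_cong_sym[OF inverse_reflect]
          local_ints_uminus local_ints_inverse) auto
  qed
  from local_cong_add[OF local_cong_refl this, of "\<Sum>k\<in>odds. (1 / of_nat k)\<^sup>2"]
  have "local_cong p (of_nat 2 * (\<Sum>k\<in>odds. (1 / of_nat k)\<^sup>2)) (\<Sum>k=1..p-1. (1 / of_nat k)\<^sup>2)"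
    unfolding sum_parity sum_evens_reflect by simp
  also note sum_inverse_squares
  finally show "local_cong p (of_nat 2 * (\<Sum>k\<in>odds. (1 / of_nat k)\<^sup>2)) (of_nat 2 * 0)" by simp
qed (use p_ge in auto)

text \<open>
  The sum \<open>B\<close> reproduces itself with another factor. Reflecting the even index gives minus a sum
  over pairs of odd numbers with \<open>j + k < p\<close>; splitting \<open>1/(jk)\<close> into partial fractions
  and putting \<open>m = j + k\<close>, which is even and exceeds \<open>j\<close>, gives back \<open>B\<close> twice. So
  \<open>B\<close> is congruent to \<open>-2 B\<close>.
\<close>
lemma sum_odd_less_even:
  "local_cong p (\<Sum>m\<in>evens. \<Sum>j | j \<in> odds \<and> j \<le> m. 1 / of_nat j * (1 / of_nat m)) 0"
    (is "local_cong p ?B 0")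
proof (rule local_cong_cancel[of 3])
  define Q where "Q = {(j, k). j \<in> odds \<and> k \<in> odds \<and> j + k < p}"
  define C where "C = (\<Sum>(j, k)\<in>Q. 1 / of_nat j * (1 / of_nat k) :: rat)"
  have fin: "finite odds" "finite evens" by (simp_all add: odds_def evens_def)
  have B: "?B = (\<Sum>(m, j)\<in>(SIGMA m:evens. {j. j \<in> odds \<and> j \<le> m}). 1 / of_nat j * (1 / of_nat m))"
    using fin by (subst sum.Sigma) auto
  have gap: "Suc 0 \<le> m - j" if "even m" "odd j" "j \<le> m" for m j :: nat
    using that by (metis One_nat_def Suc_leI le_neq_implies_less zero_less_diff)
  have B_ne: "a \<noteq> b" if "even a" "odd b" for a b :: nat
    using that by auto
  \<comment> \<open>The condition \<open>j \<le> m\<close> becomes \<open>j + k \<le> p\<close>, where parity rules out equality.\<close>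
  have "?B = (\<Sum>(j, k)\<in>Q. 1 / of_nat j * (1 / of_nat (p - k)))"
    unfolding B
    by (rule sum.reindex_bij_witness[of _ "\<lambda>(j, k). (p - k, j)" "\<lambda>(m, j). (j, p - m)"])
      (use p_odd B_ne in \<open>auto simp: Q_def odds_def evens_def less_diff_conv less_le\<close>)
  also have "local_cong p \<dots> (\<Sum>(j, k)\<in>Q. 1 / of_nat j * (- (1 / of_nat k)))"
    unfolding case_prod_unfold
    by (intro local_cong_sum local_cong_mult_left local_ints_inverse inverse_reflect)
      (auto simp: Q_def dest: odds_range)
  also have "(\<Sum>(j, k)\<in>Q. 1 / of_nat j * (- (1 / of_nat k))) = - C"
    unfolding C_def by (simp add: case_prod_unfold sum_negf)
  \<comment> \<open>An identity of rational numbers: no reduction modulo \<open>p\<close> takes place in this step.\<close>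
  also have "C = 2 * ?B"
  proof -
    have "C = (\<Sum>(j, k)\<in>Q. 1 / of_nat j * (1 / of_nat (j + k)) + 1 / of_nat k * (1 / of_nat (j + k)))"
      unfolding C_def
    proof (rule sum.cong[OF refl], clarify)
      fix j k assume "(j, k) \<in> Q"
      then have "j > 0" "k > 0" by (auto simp: Q_def dest: odds_range)
      then have "(of_nat j :: rat) > 0" "(of_nat k :: rat) > 0" by simp_all
      then have "(of_nat j :: rat) + of_nat k \<noteq> 0" "(of_nat j :: rat) \<noteq> 0" "(of_nat k :: rat) \<noteq> 0"
        by linarith+
      then show "1 / of_nat j * (1 / of_nat k)
        = 1 / of_nat j * (1 / of_nat (j + k)) + 1 / of_nat k * (1 / of_nat (j + k) :: rat)"
        by (simp add: divide_simps)
    qed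
    also have "\<dots> = (\<Sum>(j, k)\<in>Q. 1 / of_nat j * (1 / of_nat (j + k)))
        + (\<Sum>(j, k)\<in>Q. 1 / of_nat k * (1 / of_nat (j + k)))"
      by (simp add: case_prod_unfold sum.distrib)
    also have "(\<Sum>(j, k)\<in>Q. 1 / of_nat k * (1 / of_nat (j + k) :: rat))
        = (\<Sum>(j, k)\<in>Q. 1 / of_nat j * (1 / of_nat (j + k)))"
      by (rule sum.reindex_bij_witness[of _ "\<lambda>(j, k). (k, j)" "\<lambda>(j, k). (k, j)"])
        (auto simp: Q_def add.commute)
    also have "(\<Sum>(j, k)\<in>Q. 1 / of_nat j * (1 / of_nat (j + k))) = ?B"
      unfolding B
      by (rule sum.reindex_bij_witness[of _ "\<lambda>(m, j). (j, m - j)" "\<lambda>(j, k). (j + k, j)"])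
        (use gap in \<open>auto simp: Q_def odds_def evens_def\<close>)
    finally show ?thesis by simp
  qed
  finally have "local_cong p (?B + 2 * ?B) (- (2 * ?B) + 2 * ?B)"
    by (intro local_cong_add) auto
  then show "local_cong p (of_nat 3 * ?B) (of_nat 3 * 0)" by simp
qed (use p_ge in auto)

lemma fermat_quotient_2_square:
  "local_cong p ((fermat_quotient p 2)\<^sup>2) (- (\<Sum>k=1..p-1. 2 ^ k / (of_nat k)\<^sup>2))"
proof -
  let ?S = "\<Sum>k\<in>odds. 1 / of_nat k :: rat" and ?S2 = "\<Sum>k\<in>odds. (1 / of_nat k)\<^sup>2 :: rat"
  let ?B = "\<Sum>m\<in>evens. \<Sum>j | j \<in> odds \<and> j \<le> m. 1 / of_nat j * (1 / of_nat m :: rat)"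
  have fin: "finite odds" by (simp add: odds_def)
  have inner: "(\<Sum>j=1..m. ((-1) ^ j - 1) / (of_nat j * of_nat m))
      = - 2 * (\<Sum>j | j \<in> odds \<and> j \<le> m. 1 / of_nat j * (1 / of_nat m :: rat))"
    if "m \<in> {1..p-1}" for m
    unfolding sum_distrib_left
    by (rule sum.mono_neutral_cong_right) (use that in \<open>auto simp: odds_def\<close>)
  have "local_cong p (\<Sum>k=1..p-1. 2 ^ k / (of_nat k)\<^sup>2)
     (\<Sum>m=1..p-1. \<Sum>j=1..m. ((-1) ^ j - 1) / (of_nat j * of_nat m))"
    using dilog_cong[of 2] by simp
  also have "\<dots> = - 2 * (\<Sum>m=1..p-1. \<Sum>j | j \<in> odds \<and> j \<le> m. 1 / of_nat j * (1 / of_nat m :: rat))"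
    using inner by (simp only: sum_distrib_left[of "-2"] cong: sum.cong)
  also have "\<dots> = - (?S\<^sup>2) - ?S2 - 2 * ?B"
    unfolding sum_parity using sum_le_pairs[OF fin, of "\<lambda>j. 1 / of_nat j :: rat"]
    by (simp add: algebra_simps)
  finally have "local_cong p (- (\<Sum>k=1..p-1. 2 ^ k / (of_nat k)\<^sup>2)) (- (- (?S\<^sup>2) - ?S2 - 2 * ?B))"
    by (rule local_cong_uminus)
  then have "local_cong p (- (\<Sum>k=1..p-1. 2 ^ k / (of_nat k)\<^sup>2)) (?S\<^sup>2 + (?S2 + 2 * ?B))"
    by (simp add: algebra_simps)
  also have "local_cong p (?S\<^sup>2 + (?S2 + 2 * ?B)) (?S\<^sup>2 + (0 + 2 * 0))"
    by (intro local_cong_add local_cong_mult_left local_cong_refl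
        sum_odds_inverse_squares sum_odd_less_even) simp
  also have "local_cong p (?S\<^sup>2 + (0 + 2 * 0)) ((fermat_quotient p 2)\<^sup>2)"
  proof -
    have S: "?S \<in> local_ints p" by (auto intro!: local_ints_intros dest: odds_range)
    obtain r where r: "r \<in> local_ints p" "fermat_quotient p 2 - ?S = of_nat p * r"
      using fermat_quotient_2_cong unfolding local_cong_def by blast
    then have "fermat_quotient p 2 = ?S + of_nat p * r" by simp
    then have "fermat_quotient p 2 \<in> local_ints p" using S r(1) by (auto intro!: local_ints_intros)
    then show ?thesis
      using local_cong_power2[OF S _ local_cong_sym[OF fermat_quotient_2_cong]] by simp
  qed
  finally show ?thesis by (rule local_cong_sym)
qed

end

end

theorem mainTheorem1:
  fixes p :: nat
  assumes "prime p" and "p \<ge> 5"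
  shows "rat_cong p ((fermat_quotient p 2)\<^sup>2) (- (\<Sum>k=1..p-1. 2 ^ k / (of_nat k)\<^sup>2))"
proof -
  let ?G = "- (\<Sum>k=1..p-1. 2 ^ k / (of_nat k)\<^sup>2) :: rat"
  note cong = fermat_quotient_2_square[OF assms]
  have G: "?G \<in> local_ints p"
  proof (intro local_ints_uminus[OF assms(1)] local_ints_sum[OF assms(1)])
    fix k assume k: "k \<in> {1..p-1}"
    then have "2 ^ k / of_nat k / of_nat k \<in> local_ints p"
      using assms(1) by (intro local_ints_div local_ints_power local_ints_simps) auto
    then show "2 ^ k / (of_nat k)\<^sup>2 \<in> local_ints p" by (simp add: power2_eq_square)
  qed
  obtain r where r: "r \<in> local_ints p" "(fermat_quotient p 2)\<^sup>2 - ?G = of_nat p * r"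
    using cong unfolding local_cong_def by blast
  then have eq: "(fermat_quotient p 2)\<^sup>2 = ?G + of_nat p * r" by (simp only: diff_eq_eq add.commute)
  have "(fermat_quotient p 2)\<^sup>2 \<in> local_ints p"
    unfolding eq using assms(1) G r(1)
    by (intro local_ints_add local_ints_mult local_ints_simps)
  from local_cong_imp_rat_cong[OF assms(1) this G cong] show ?thesis .
qed

end
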